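(* Let $\mathcal{A}, \mathcal{B} \in \mathbb{R}^{m \times n \times p}$ be orthogonally equivalent. Then $\mathcal{A}$ and $\mathcal{B}$ have the same T-rank and the same set of singular values.
   Context: For a third order tensor $\mathcal{A} = (a_{ijk}) \in \mathbb{R}^{m\times n\times p}$, let $A^{(k)} = (a_{ijk})_{i,j} \in \mathbb{R}^{m\times n}$, $k=1,\dots,p$, be its frontal slices. $\mathrm{bcirc}(\mathcal{A}) \in \mathbb{R}^{mp\times np}$ is the block circulant matrix whose $(s,t)$ block is $A^{(r)}$ with $r \in \{1,\dots,p\}$, $r \equiv s-t+1 \pmod p$ (first block column $A^{(1)},A^{(2)},\dots,A^{(p)}$); $\mathrm{bcirc}^{-1}$ is its inverse, defined on block circulant matrices. T-product: for $\mathcal{A}\in\mathbb{R}^{m\times s\times p}$, $\mathcal{B}\in\mathbb{R}^{s\times n\times p}$, $\mathcal{A}*\mathcal{B} := \mathrm{bcirc}^{-1}(\mathrm{bcirc}(\mathcal{A})\,\mathrm{bcirc}(\mathcal{B})) \in \mathbb{R}^{m\times n\times p}$. Transpose: $\mathcal{A}^\top := \mathrm{bcirc}^{-1}(\mathrm{bcirc}(\mathcal{A})^\top)$. Identity tensor: $\mathcal{I}_{nnp} := \mathrm{bcirc}^{-1}(I_{np})$. A tensor $\mathcal{Q}\in\mathbb{R}^{n\times n\times p}$ is orthogonal if $\mathcal{Q}*\mathcal{Q}^\top=\mathcal{Q}^\top*\mathcal{Q}=\mathcal{I}_{nnp}$. Tensors $\mathcal{A},\mathcal{B}\in\mathbb{R}^{m\times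 n\times p}$ are orthogonally equivalent if $\mathcal{A}=\mathcal{Y}*\mathcal{B}*\mathcal{Z}^\top$ for some orthogonal tensors $\mathcal{Y}\in\mathbb{R}^{m\times m\times p}$, $\mathcal{Z}\in\mathbb{R}^{n\times n\times p}$. Kilmer-Martin mapping: put $\omega=e^{-2\pi\sqrt{-1}/p}$ and $\Delta^{(k)}=\sum_{l=1}^p \omega^{(k-1)(l-1)}A^{(l)}\in\mathbb{C}^{m\times n}$ for $k=1,\dots,p$. Let $\Sigma(1,1,k)\ge\Sigma(2,2,k)\ge\cdots\ge\Sigma(\min\{m,n\},\min\{m,n\},k)\ge 0$ be the singular values of the matrix $\Delta^{(k)}$ in non-increasing order. Then $\mathcal{S}=\mathcal{S}(\mathcal{A})\in\mathbb{R}^{m\times n\times p}$ is the (real) tensor all of whose frontal slices are diagonal, with diagonal entries $\mathcal{S}(i,i,k)=\frac1p\sum_{l=1}^p\bar\omega^{(k-1)(l-1)}\Sigma(i,i,l)$ for $1\le i\le\min\{m,n\}$, $1\le k\le p$. The singular values of $\mathcal{A}$ are the absolute values $|\mathcal{S}(i,i,k)|$, $1\le i\le\min\{m,n\}$, $1\le k\le p$, of the diagonal entries of the frontal slices of $\mathcal{S}=\mathcal{S}(\mathcal{A})$. The T-rank of $\mathcal{A}$ is the number of nonzero singular values of $\mathcal{A}$, i.e. the number of pairs $(i,k)$ with $\mathcal{S}(i,i,k)\neq0$. *)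

theory Defs
  imports
    "Jordan_Normal_Form.Schur_Decomposition"
    "HOL-Computational_Algebra.Fundamental_Theorem_Algebra"
begin

section \<open>Third order tensors and the T-product\<close>

text \<open>
  A tensor is the list of its frontal slices. All indices count from 0, so the
  list element \<open>A ! k\<close> is the slice that is usually written \<open>A\<^sup>(\<^sup>k\<^sup>+\<^sup>1\<^sup>)\<close>.
\<close>

type_synonym tensor = "real mat list"

definition tensors :: "nat \<Rightarrow> nat \<Rightarrow> nat \<Rightarrow> tensor set" where
  "tensors m n p = {A. length A = p \<and> set A \<subseteq> carrier_mat m n}"

text \<open>Only meaningful for tensors with at least one frontal slice.\<close>

definition nrows :: "tensor \<Rightarrow> nat" where
  "nrows A = dim_row (hd A)"

definition ncols :: "tensor \<Rightarrow> nat" where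
  "ncols A = dim_col (hd A)"

text \<open>
  With blocks counted from 0, the block in position \<open>(s, t)\<close> is the slice with index
  \<open>s - t\<close> modulo \<open>p\<close>; adding \<open>p\<close> first avoids truncated subtraction, as \<open>t < p\<close>.
\<close>

definition bcirc :: "tensor \<Rightarrow> real mat" where
  "bcirc A = (let m = nrows A; n = ncols A; p = length A in
     mat (m * p) (n * p)
       (\<lambda>(i, j). (A ! ((i div m + p - j div n) mod p)) $$ (i mod m, j mod n)))"

definition bcirc_inv :: "nat \<Rightarrow> nat \<Rightarrow> nat \<Rightarrow> real mat \<Rightarrow> tensor" where
  "bcirc_inv m n p = the_inv_into (tensors m n p) bcirc"

definition tprod :: "tensor \<Rightarrow> tensor \<Rightarrow> tensor" (infixl "*\<^sub>T" 70) where
  "A *\<^sub>T B = bcirc_inv (nrows A) (ncols B) (length A) (bcirc A * bcirc B)"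

definition ttranspose :: "tensor \<Rightarrow> tensor" where
  "ttranspose A = bcirc_inv (ncols A) (nrows A) (length A) (transpose_mat (bcirc A))"

definition tidentity :: "nat \<Rightarrow> nat \<Rightarrow> tensor" where
  "tidentity n p = bcirc_inv n n p (1\<^sub>m (n * p))"

definition orthogonal_tensor :: "nat \<Rightarrow> nat \<Rightarrow> tensor \<Rightarrow> bool" where
  "orthogonal_tensor n p Q \<longleftrightarrow> Q \<in> tensors n n p \<and>
     Q *\<^sub>T ttranspose Q = tidentity n p \<and> ttranspose Q *\<^sub>T Q = tidentity n p"

definition orthogonally_equivalent :: "nat \<Rightarrow> nat \<Rightarrow> nat \<Rightarrow> tensor \<Rightarrow> tensor \<Rightarrow> bool" where
  "orthogonally_equivalent m n p A B \<longleftrightarrow> A \<in> tensors m n p \<and> B \<in> tensors m n p \<and>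
     (\<exists>Y Z. orthogonal_tensor m p Y \<and> orthogonal_tensor n p Z \<and> A = Y *\<^sub>T B *\<^sub>T ttranspose Z)"


section \<open>Singular values of a complex matrix\<close>

text \<open>
  For an \<open>m \<times> n\<close> matrix \<open>M\<close> the singular values are the square roots of the eigenvalues of
  \<open>M\<^sup>* M\<close>, with multiplicity and in non-increasing order. \<open>M\<^sup>* M\<close> has \<open>n\<close> eigenvalues, all real
  and nonnegative, and if \<open>n > m\<close> at least \<open>n - m\<close> of them vanish; hence the first \<open>min m n\<close>
  are kept.
\<close>

definition singular_values :: "complex mat \<Rightarrow> real list" where
  "singular_values M = take (min (dim_row M) (dim_col M))
     (rev (sorted_list_of_multiset
       (image_mset (\<lambda>z. sqrt (Re z)) (proots (char_poly (mat_adjoint M * M))))))"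


section \<open>The Kilmer-Martin mapping\<close>

definition omega :: "nat \<Rightarrow> complex" where
  "omega p = exp (- 2 * of_real pi * \<i> / of_nat p)"

definition Delta :: "tensor \<Rightarrow> nat \<Rightarrow> complex mat" where
  "Delta A k = mat (nrows A) (ncols A)
     (\<lambda>(i, j). \<Sum>l<length A. omega (length A) ^ (k * l) * of_real ((A ! l) $$ (i, j)))"

definition km_coeff :: "tensor \<Rightarrow> nat \<Rightarrow> nat \<Rightarrow> complex" where
  "km_coeff A i k = 1 / of_nat (length A) *
     (\<Sum>l<length A. cnj (omega (length A)) ^ (k * l) * of_real (singular_values (Delta A l) ! i))"

text \<open>
  The real part only serves to obtain a real tensor: the coefficients are real, see
  \<open>km_coeff_real\<close> below.
\<close>

definition kilmer_martin :: "tensor \<Rightarrow> tensor" where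
  "kilmer_martin A = map (\<lambda>k. mat (nrows A) (ncols A)
     (\<lambda>(i, j). if i = j then Re (km_coeff A i k) else 0)) [0..<length A]"

definition tensor_singular_values :: "tensor \<Rightarrow> real set" where
  "tensor_singular_values A =
     {\<bar>(kilmer_martin A ! k) $$ (i, i)\<bar> | i k. i < min (nrows A) (ncols A) \<and> k < length A}"

definition T_rank :: "tensor \<Rightarrow> nat" where
  "T_rank A = card {(i, k). i < min (nrows A) (ncols A) \<and> k < length A \<and>
     (kilmer_martin A ! k) $$ (i, i) \<noteq> 0}"


section \<open>Well-definedness\<close>

lemma tensors_dims:
  assumes "A \<in> tensors m n p" "0 < p"
  shows "nrows A = m" "ncols A = n" "length A = p"
  using assms by (auto simp: tensors_def nrows_def ncols_def dest!: hd_in_set)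

lemma inj_on_bcirc:
  assumes p: "0 < p"
  shows "inj_on bcirc (tensors m n p)"
proof (rule inj_onI)
  fix A B assume A: "A \<in> tensors m n p" and B: "B \<in> tensors m n p" and eq: "bcirc A = bcirc B"
  note dA = tensors_dims[OF A p] and dB = tensors_dims[OF B p]
  show "A = B"
  proof (rule nth_equalityI)
    show "length A = length B" using dA dB by simp
    fix k assume "k < length A"
    then have k: "k < p" using dA by simp
    have cA: "A ! k \<in> carrier_mat m n" and cB: "B ! k \<in> carrier_mat m n"
      using A B k dA dB by (auto simp: tensors_def subset_iff)
    show "A ! k = B ! k"
    proof (rule eq_matI)
      fix i j assume "i < dim_row (B ! k)" "j < dim_col (B ! k)"
      then have i: "i < m" and j: "j < n" using cB by auto
      have r: "k * m + i < m * p"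
      proof -
        have "k * m + i < Suc k * m" using i by simp
        also have "\<dots> \<le> p * m" using k by (intro mult_right_mono) auto
        finally show ?thesis by (simp add: mult.commute)
      qed
      have c: "j < n * p" using j p by (cases p) auto
      have "bcirc A $$ (k * m + i, j) = bcirc B $$ (k * m + i, j)" using eq by simp
      then show "A ! k $$ (i, j) = B ! k $$ (i, j)"
        using r c i j k by (simp add: bcirc_def Let_def dA dB)
    qed (use cA cB in auto)
  qed
qed

lemma length_singular_values:
  "length (singular_values M) = min (dim_row M) (dim_col M)"
proof -
  have "mat_adjoint M * M \<in> carrier_mat (dim_col M) (dim_col M)"
    by (auto simp: mat_adjoint_def)
  then have "size (proots (char_poly (mat_adjoint M * M))) = dim_col M"
    by (simp add: size_proots_complex degree_monic_char_poly)
  moreover have "length (sorted_list_of_multiset N) = size N" for N :: "real multiset"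
    by (metis mset_sorted_list_of_multiset size_mset)
  ultimately show ?thesis
    by (simp add: singular_values_def)
qed

lemma omega_eq_cis: "omega p = cis (- (2 * pi / real p))"
  by (simp add: omega_def cis_conv_exp mult_ac)

lemma omega_power_p: "0 < p \<Longrightarrow> omega p ^ p = 1"
  unfolding omega_eq_cis Complex.DeMoivre by (simp add: complex_eq_iff)

lemma cnj_omega: "cnj (omega p) = inverse (omega p)"
  by (simp add: omega_eq_cis cis_cnj)

lemma omega_power_reflect:
  assumes "0 < p" "l < p"
  shows "omega p ^ (k * ((p - l) mod p)) = cnj (omega p) ^ (k * l)"
proof (cases "l = 0")
  case False
  have "k * (p - l) + k * l = p * k"
    using assms by (metis distrib_left le_add_diff_inverse2 less_imp_le mult.commute)
  then have "omega p ^ (k * (p - l)) * omega p ^ (k * l) = (omega p ^ p) ^ k"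
    by (metis power_add power_mult)
  then have "omega p ^ (k * (p - l)) * omega p ^ (k * l) = 1"
    using omega_power_p assms by simp
  then have "omega p ^ (k * (p - l)) = inverse (omega p ^ (k * l))"
    by (metis inverse_unique mult.commute)
  then show ?thesis
    using False assms by (simp add: cnj_omega power_inverse)
qed simp

interpretation cnj_hom: field_hom cnj
  by unfold_locales auto

interpretation cnj_poly_hom: map_poly_inj_idom_divide_hom cnj
  by unfold_locales

lemma proots_map_poly_cnj:
  assumes "f \<noteq> 0"
  shows "proots (map_poly cnj f) = image_mset cnj (proots f)"
proof (rule multiset_eqI)
  fix x
  have "order (cnj (cnj x)) (map_poly cnj f) = order (cnj x) f"
    by (rule cnj_poly_hom.order_hom)
  moreover have "count (image_mset cnj (proots f)) x = order (cnj x) f"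
  proof -
    have "cnj -` {x} = {cnj x}" by auto
    then have "count (image_mset cnj (proots f)) x = count (proots f) (cnj x)"
      by (cases "cnj x \<in># proots f") (simp_all add: count_image_mset not_in_iff)
    then show ?thesis using assms by simp
  qed
  ultimately show "count (proots (map_poly cnj f)) x = count (image_mset cnj (proots f)) x"
    using assms by simp
qed

lemma singular_values_cnj: "singular_values (map_mat cnj M) = singular_values M"
proof -
  have adj: "mat_adjoint (map_mat cnj M) = map_mat cnj (mat_adjoint M)"
    by (rule eq_matI) (auto simp: mat_adjoint_def mat_of_rows_index)
  have cM: "M \<in> carrier_mat (dim_row M) (dim_col M)"
    and ca: "mat_adjoint M \<in> carrier_mat (dim_col M) (dim_row M)"
    by (auto simp: mat_adjoint_def)
  have mult: "mat_adjoint (map_mat cnj M) * map_mat cnj M = map_mat cnj (mat_adjoint M * M)"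
    unfolding adj by (rule cnj_hom.mat_hom_mult[OF ca cM, symmetric])
  have sq: "mat_adjoint M * M \<in> carrier_mat (dim_col M) (dim_col M)"
    by (rule mult_carrier_mat[OF ca cM])
  have nz: "char_poly (mat_adjoint M * M) \<noteq> 0"
    using degree_monic_char_poly[OF sq] by auto
  show ?thesis
    unfolding singular_values_def mult cnj_hom.char_poly_hom[OF sq]
    by (simp add: proots_map_poly_cnj[OF nz] multiset.map_comp o_def)
qed

lemma Delta_reflect:
  assumes "l < length A"
  shows "Delta A ((length A - l) mod length A) = map_mat cnj (Delta A l)"
proof (rule eq_matI)
  let ?p = "length A"
  have "omega ?p ^ (((?p - l) mod ?p) * q) = cnj (omega ?p ^ (l * q))" for q
    using omega_power_reflect[of ?p l q] assms by (cases A) (simp_all add: mult.commute)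
  then show "Delta A ((?p - l) mod ?p) $$ (i, j) = map_mat cnj (Delta A l) $$ (i, j)"
    if "i < dim_row (map_mat cnj (Delta A l))" "j < dim_col (map_mat cnj (Delta A l))" for i j
    using that by (simp add: Delta_def)
qed (simp_all add: Delta_def)

lemma km_coeff_real: "km_coeff A i k \<in> \<real>"
proof -
  let ?p = "length A"
  define s where "s l = (of_real (singular_values (Delta A l) ! i) :: complex)" for l
  define r where "r l = (?p - l) mod ?p" for l
  define S where "S = (\<Sum>l<?p. cnj (omega ?p) ^ (k * l) * s l)"
  have sr: "s (r l) = s l" if "l < ?p" for l
    using Delta_reflect[OF that] by (simp add: s_def r_def singular_values_cnj)
  have rr: "r (r l) = l" "r l < ?p" if "l < ?p" for l
    using that by (cases "l = 0"; auto simp: r_def)+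
  have "cnj S = (\<Sum>l<?p. omega ?p ^ (k * l) * s l)"
    by (simp add: S_def s_def)
  also have "\<dots> = (\<Sum>l<?p. omega ?p ^ (k * r l) * s (r l))"
    by (rule sum.reindex_bij_witness[of _ r r]) (auto simp: rr)
  also have "\<dots> = S"
    unfolding S_def
  proof (rule sum.cong)
    fix l assume l: "l \<in> {..<?p}"
    then have "omega ?p ^ (k * r l) = cnj (omega ?p) ^ (k * l)"
      unfolding r_def by (intro omega_power_reflect) auto
    then show "omega ?p ^ (k * r l) * s (r l) = cnj (omega ?p) ^ (k * l) * s l"
      using sr l by simp
  qed simp
  finally have "S \<in> \<real>" by (simp add: Reals_cnj_iff)
  then show ?thesis
    by (simp add: km_coeff_def S_def s_def)
qed

end

theory Submission
  imports Defs
begin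

text \<open>
  The slices \<open>Delta A k\<close> are the blocks of \<open>bcirc A\<close> after block diagonalisation by the discrete
  Fourier transform. A product of block circulant matrices is again block circulant, so
  \<open>*\<^sub>T\<close> is the cyclic convolution of the lists of slices (\<open>tprod_eq_convolution\<close>), and for
  each \<open>k\<close> the map \<open>\<lambda>A. Delta A k\<close> turns it into the matrix product (\<open>Delta_tprod\<close>). Since the
  slices are real, the map also turns \<open>ttranspose\<close> into the adjoint (\<open>Delta_ttranspose\<close>), and it
  sends the identity tensor to the identity matrix. Orthogonal tensors therefore become unitary
  matrices, and \<open>A = Y *\<^sub>T B *\<^sub>T ttranspose Z\<close> becomes
  \<open>Delta A k = Delta Y k * Delta B k * mat_adjoint (Delta Z k)\<close>.

  Multiplying by unitary matrices does not change the singular values of a matrix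
  (\<open>singular_values_unitary_invariant\<close>). The tensor \<open>kilmer_martin A\<close> depends on \<open>A\<close> only through its
  format and the singular values of the \<open>Delta A k\<close>, so \<open>A\<close> and \<open>B\<close> have the very same
  Kilmer-Martin tensor; the T-rank and the singular values are read off from it.
\<close>

section \<open>Block circulant matrices and cyclic convolution\<close>

text \<open>
  The tensor operations are defined through the inverse of \<open>bcirc\<close>, which is meaningful only on
  block circulant matrices. Exhibiting a preimage settles membership in the range and the value
  of the inverse at once.
\<close>

lemma bcirc_inv_eqI:
  assumes "0 < p" "C \<in> tensors m n p" "bcirc C = M"
  shows "bcirc_inv m n p M = C"
  unfolding bcirc_inv_def assms(3)[symmetric]
  by (rule the_inv_into_f_f[OF inj_on_bcirc[OF assms(1)] assms(2)])

lemma slice_carrier: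
  assumes "A \<in> tensors m n p" "k < p"
  shows "A ! k \<in> carrier_mat m n"
  using assms by (auto simp: tensors_def subset_iff)

lemma bcirc_carrier:
  assumes "A \<in> tensors m n p" "0 < p"
  shows "bcirc A \<in> carrier_mat (m * p) (n * p)"
  by (simp add: bcirc_def Let_def tensors_dims[OF assms])

lemma bcirc_index:
  assumes "A \<in> tensors m n p" "0 < p" "i < m * p" "j < n * p"
  shows "bcirc A $$ (i, j) = (A ! ((i div m + p - j div n) mod p)) $$ (i mod m, j mod n)"
  using assms(3,4) by (simp add: bcirc_def Let_def tensors_dims[OF assms(1,2)])

lemma block_index_bounds:
  fixes i m p :: nat
  assumes "i < m * p"
  shows "0 < m" "i mod m < m" "i div m < p"
  using assms by (cases "m = 0"; simp add: less_mult_imp_div_less mult.commute)+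

text \<open>
  Splits the inner index of a product of two block matrices into block number and position
  inside the block.
\<close>

lemma sum_over_blocks:
  fixes f :: "nat \<Rightarrow> nat \<Rightarrow> 'a :: comm_monoid_add"
  shows "(\<Sum>u\<in>{0..<n * p}. f (u div n) (u mod n)) = (\<Sum>t<p. \<Sum>q<n. f t q)"
proof -
  have "(\<Sum>u\<in>{0..<n * p}. f (u div n) (u mod n)) = (\<Sum>(t, q)\<in>{..<p} \<times> {..<n}. f t q)"
  proof (rule sum.reindex_bij_witness[of _ "\<lambda>(t, q). t * n + q" "\<lambda>u. (u div n, u mod n)"])
    fix a assume "a \<in> {..<p} \<times> {..<n}"
    then obtain t q where a: "a = (t, q)" "t < p" "q < n" by auto
    have "t * n + q < Suc t * n" using a by simp
    also have "\<dots> \<le> p * n" using a by (intro mult_right_mono) auto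
    finally show "(case a of (t, q) \<Rightarrow> t * n + q) \<in> {0..<n * p}"
      using a by (simp add: mult.commute)
  qed (auto dest: block_index_bounds)
  then show ?thesis by (simp add: sum.cartesian_product)
qed

text \<open>
  This is \<open>(s - t) - (u - t) = s - u\<close> modulo \<open>p\<close>, with \<open>p\<close> added before each subtraction
  as in the definition of \<open>bcirc\<close>.
\<close>

lemma cyclic_diff_twice:
  fixes s t u p :: nat
  assumes "s < p" "t < p" "u < p"
  shows "((s + p - t) mod p + p - (u + p - t) mod p) mod p = (s + p - u) mod p"
proof -
  have "int (((s + p - t) mod p + p - (u + p - t) mod p) mod p) = int ((s + p - u) mod p)"
    using assms
    by (simp add: of_nat_mod of_nat_diff trans_le_add2 mod_simps) (simp add: add_diff_eq)
  then show ?thesis by linarith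
qed

lemma sum_cyclic_shift:
  fixes f :: "nat \<Rightarrow> 'a :: comm_monoid_add"
  assumes "t < p"
  shows "(\<Sum>u<p. f ((u + p - t) mod p)) = (\<Sum>l<p. f l)"
proof (rule sum.reindex_bij_witness[of _ "\<lambda>l. (l + t) mod p" "\<lambda>u. (u + p - t) mod p"])
  fix u assume u: "u \<in> {..<p}"
  have "((u + p - t) mod p + t) mod p = (u + p - t + t) mod p" by (rule mod_add_left_eq)
  then show "((u + p - t) mod p + t) mod p = u" using u assms by simp
next
  fix l assume l: "l \<in> {..<p}"
  show "((l + t) mod p + p - t) mod p = l"
  proof -
    have "((l + t) mod p + p - t) mod p = ((l + t) mod p + (p - t)) mod p" using assms by simp
    also have "\<dots> = (l + t + (p - t)) mod p" by (rule mod_add_left_eq)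
    finally show ?thesis using l assms by simp
  qed
qed (use assms in auto)

definition cyclic_convolution :: "tensor \<Rightarrow> tensor \<Rightarrow> tensor" where
  "cyclic_convolution A B = map (\<lambda>k. mat (nrows A) (ncols B) (\<lambda>(i, j).
     \<Sum>l<length A. \<Sum>q<ncols A. (A ! ((k + length A - l) mod length A)) $$ (i, q) * (B ! l) $$ (q, j)))
     [0..<length A]"

text \<open>
  Block \<open>(a, b)\<close> of \<open>bcirc A * bcirc B\<close> is the sum over \<open>t\<close> of the products of slice \<open>a - t\<close> of
  \<open>A\<close> and slice \<open>t - b\<close> of \<open>B\<close>. Substituting \<open>l = t - b\<close> shows that it depends on \<open>a - b\<close> only,
  so the product is block circulant.
\<close>

lemma tprod_eq_convolution:
  assumes p: "0 < p" and A: "A \<in> tensors m s p" and B: "B \<in> tensors s n p"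
  shows "A *\<^sub>T B = cyclic_convolution A B" "cyclic_convolution A B \<in> tensors m n p"
proof -
  note d = tensors_dims[OF A p] tensors_dims[OF B p]
  let ?C = "cyclic_convolution A B"
  show C: "?C \<in> tensors m n p"
    by (auto simp: tensors_def cyclic_convolution_def d)
  have "bcirc ?C = bcirc A * bcirc B"
  proof (rule eq_matI)
    fix x y assume "x < dim_row (bcirc A * bcirc B)" "y < dim_col (bcirc A * bcirc B)"
    then have x: "x < m * p" and y: "y < n * p"
      using bcirc_carrier[OF A p] bcirc_carrier[OF B p] by auto
    define i a j b where "i = x mod m" and "a = x div m" and "j = y mod n" and "b = y div n"
    have bds: "i < m" "a < p" "j < n" "b < p"
      using block_index_bounds[OF x] block_index_bounds[OF y] by (auto simp: i_def a_def j_def b_def)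
    have "(bcirc A * bcirc B) $$ (x, y) = (\<Sum>u\<in>{0..<s * p}. bcirc A $$ (x, u) * bcirc B $$ (u, y))"
      using x y bcirc_carrier[OF A p] bcirc_carrier[OF B p] by (simp add: scalar_prod_def)
    also have "\<dots> = (\<Sum>u\<in>{0..<s * p}. (A ! ((a + p - u div s) mod p)) $$ (i, u mod s)
          * (B ! ((u div s + p - b) mod p)) $$ (u mod s, j))"
      by (rule sum.cong) (auto simp: bcirc_index[OF A p x] bcirc_index[OF B p _ y] i_def a_def j_def b_def)
    also have "\<dots> = (\<Sum>t<p. \<Sum>q<s. (A ! ((a + p - t) mod p)) $$ (i, q)
          * (B ! ((t + p - b) mod p)) $$ (q, j))"
      by (rule sum_over_blocks)
    also have "\<dots> = (\<Sum>t<p. \<Sum>q<s. (A ! (((a + p - b) mod p + p - (t + p - b) mod p) mod p)) $$ (i, q)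
          * (B ! ((t + p - b) mod p)) $$ (q, j))"
      using bds by (intro sum.cong refl) (simp add: cyclic_diff_twice)
    also have "\<dots> = (\<Sum>l<p. \<Sum>q<s. (A ! (((a + p - b) mod p + p - l) mod p)) $$ (i, q)
          * (B ! l) $$ (q, j))"
      using sum_cyclic_shift[OF \<open>b < p\<close>, of "\<lambda>l. \<Sum>q<s. (A ! (((a + p - b) mod p + p - l) mod p)) $$ (i, q)
          * (B ! l) $$ (q, j)"] .
    also have "\<dots> = bcirc ?C $$ (x, y)"
      using bds p
      by (simp add: bcirc_index[OF C p x y] flip: i_def a_def j_def b_def)
         (simp add: cyclic_convolution_def d)
    finally show "bcirc ?C $$ (x, y) = (bcirc A * bcirc B) $$ (x, y)" by simp
  qed (use bcirc_carrier[OF A p] bcirc_carrier[OF B p] bcirc_carrier[OF C p] in auto)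
  then show "A *\<^sub>T B = ?C"
    unfolding tprod_def d by (intro bcirc_inv_eqI[OF p C])
qed

text \<open>
  Transposing \<open>bcirc A\<close> exchanges the blocks \<open>(s, t)\<close> and \<open>(t, s)\<close>, hence negates the difference
  \<open>s - t\<close> that selects the slice.
\<close>

lemma ttranspose_eq_reflection:
  assumes p: "0 < p" and A: "A \<in> tensors m n p"
  defines "T \<equiv> map (\<lambda>k. transpose_mat (A ! ((p - k) mod p))) [0..<p]"
  shows "ttranspose A = T" "T \<in> tensors n m p"
proof -
  note d = tensors_dims[OF A p]
  show T: "T \<in> tensors n m p"
    using slice_carrier[OF A] p by (auto simp: tensors_def T_def)
  have "bcirc T = transpose_mat (bcirc A)"
  proof (rule eq_matI)
    fix x y assume "x < dim_row (transpose_mat (bcirc A))" "y < dim_col (transpose_mat (bcirc A))"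
    then have x: "x < n * p" and y: "y < m * p"
      using bcirc_carrier[OF A p] by auto
    note bx = block_index_bounds[OF x] and by' = block_index_bounds[OF y]
    have cA: "A ! (k mod p) \<in> carrier_mat m n" for k
      using p by (intro slice_carrier[OF A]) simp
    have idx: "(p - (x div n + p - y div m) mod p) mod p = (y div m + p - x div n) mod p"
      using cyclic_diff_twice[of "y div m" p "y div m" "x div n"] bx by' by simp
    show "bcirc T $$ (x, y) = transpose_mat (bcirc A) $$ (x, y)"
      using x y p bx by' bcirc_carrier[OF A p] unfolding bcirc_index[OF T p x y]
      by (simp add: bcirc_index[OF A p y x] idx T_def carrier_matD[OF cA])
  qed (use bcirc_carrier[OF A p] bcirc_carrier[OF T p] in auto)
  then show "ttranspose A = T"
    unfolding ttranspose_def d by (intro bcirc_inv_eqI[OF p T])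
qed

lemma tidentity_eq:
  fixes n p :: nat
  assumes p: "0 < p"
  defines "I \<equiv> map (\<lambda>k. if k = 0 then 1\<^sub>m n else 0\<^sub>m n n) [0..<p]"
  shows "tidentity n p = I" "I \<in> tensors n n p"
proof -
  show I: "I \<in> tensors n n p" by (auto simp: tensors_def I_def)
  have "bcirc I = 1\<^sub>m (n * p)"
  proof (rule eq_matI)
    fix x y assume "x < dim_row (1\<^sub>m (n * p))" "y < dim_col (1\<^sub>m (n * p))"
    then have x: "x < n * p" and y: "y < n * p" by auto
    note bx = block_index_bounds[OF x] and by' = block_index_bounds[OF y]
    have diff: "(x div n + p - y div n) mod p = 0 \<longleftrightarrow> x div n = y div n"
    proof
      assume "(x div n + p - y div n) mod p = 0"
      then obtain c where c: "x div n + p - y div n = p * c" by blast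
      \<comment> \<open>The multiple \<open>p * c\<close> lies strictly between \<open>0\<close> and \<open>2 * p\<close>.\<close>
      with bx by' have "0 < p * c" "p * c < p * 2" by linarith+
      then have "c = 1" by simp
      then show "x div n = y div n" using c bx by' by simp
    qed simp
    have "x = y \<longleftrightarrow> x div n = y div n \<and> x mod n = y mod n"
      by (metis div_mult_mod_eq)
    then show "bcirc I $$ (x, y) = 1\<^sub>m (n * p) $$ (x, y)"
      using x y p bx by' diff unfolding bcirc_index[OF I p x y] by (auto simp: I_def)
  qed (use bcirc_carrier[OF I p] in auto)
  then show "tidentity n p = I"
    unfolding tidentity_def by (intro bcirc_inv_eqI[OF p I])
qed

section \<open>The Fourier transform along the third mode\<close>

lemma Delta_carrier:
  assumes "A \<in> tensors m n p" "0 < p"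
  shows "Delta A k \<in> carrier_mat m n"
  by (simp add: Delta_def tensors_dims[OF assms])

lemma Delta_index:
  assumes "A \<in> tensors m n p" "0 < p" "i < m" "j < n"
  shows "Delta A k $$ (i, j) = (\<Sum>l<p. omega p ^ (k * l) * of_real ((A ! l) $$ (i, j)))"
  using assms(3,4) by (simp add: Delta_def tensors_dims[OF assms(1,2)])

lemma omega_power_mod:
  assumes "0 < p"
  shows "omega p ^ (k * (a mod p)) = omega p ^ (k * a)"
proof -
  have "omega p ^ (k * a) = omega p ^ (k * (a mod p)) * (omega p ^ p) ^ (k * (a div p))"
    by (metis distrib_left mod_mult_div_eq mult.left_commute power_add power_mult)
  then show ?thesis using omega_power_p[OF assms] by simp
qed

text \<open>
  The convolution theorem: \<open>\<omega>\<^bsup>kr\<^esup> = \<omega>\<^bsup>k(r - l)\<^esup> \<omega>\<^bsup>kl\<^esup>\<close>, and \<open>\<omega>\<^sup>p = 1\<close> allows the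
  exponents to be reduced modulo \<open>p\<close>, so that the double sum over \<open>r\<close> and \<open>l\<close> factors after a
  cyclic shift of \<open>r\<close>.
\<close>

lemma Delta_tprod:
  assumes p: "0 < p" and A: "A \<in> tensors m s p" and B: "B \<in> tensors s n p"
  shows "Delta (A *\<^sub>T B) k = Delta A k * Delta B k"
proof -
  note d = tensors_dims[OF A p] tensors_dims[OF B p]
  note C = tprod_eq_convolution[OF p A B]
  note cAB = Delta_carrier[OF A p, of k] Delta_carrier[OF B p, of k]
  show ?thesis unfolding C(1)
  proof (rule eq_matI)
    fix i j assume "i < dim_row (Delta A k * Delta B k)" "j < dim_col (Delta A k * Delta B k)"
    then have i: "i < m" and j: "j < n" using cAB by auto
    define f where "f l q = omega p ^ (k * l) * of_real ((A ! l) $$ (i, q))" for l q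
    define g where "g l q = omega p ^ (k * l) * of_real ((B ! l) $$ (q, j))" for l q
    have "Delta (cyclic_convolution A B) k $$ (i, j)
        = (\<Sum>r<p. \<Sum>l<p. \<Sum>q<s. omega p ^ (k * r)
            * of_real ((A ! ((r + p - l) mod p)) $$ (i, q)) * of_real ((B ! l) $$ (q, j)))"
      using i j
      by (simp add: Delta_index[OF C(2) p i j])
         (simp add: cyclic_convolution_def d sum_distrib_left mult.assoc)
    also have "\<dots> = (\<Sum>r<p. \<Sum>l<p. \<Sum>q<s. f ((r + p - l) mod p) q * g l q)"
    proof (intro sum.cong refl)
      fix r l q assume "r \<in> {..<p}" "l \<in> {..<p}"
      then have "k * (r + p - l) + k * l = k * r + p * k"
        by (simp add: mult.commute flip: distrib_left)
      then have "omega p ^ (k * (r + p - l)) * omega p ^ (k * l) = omega p ^ (k * r)"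
        using omega_power_p[OF p] by (metis mult.right_neutral power_add power_mult power_one)
      then have "omega p ^ (k * r) = omega p ^ (k * ((r + p - l) mod p)) * omega p ^ (k * l)"
        by (simp add: omega_power_mod[OF p])
      then show "omega p ^ (k * r) * of_real ((A ! ((r + p - l) mod p)) $$ (i, q))
          * of_real ((B ! l) $$ (q, j)) = f ((r + p - l) mod p) q * g l q"
        by (simp add: f_def g_def)
    qed
    also have "\<dots> = (\<Sum>l<p. \<Sum>r<p. \<Sum>q<s. f ((r + p - l) mod p) q * g l q)"
      by (rule sum.swap)
    also have "\<dots> = (\<Sum>l<p. \<Sum>r<p. \<Sum>q<s. f r q * g l q)"
    proof (rule sum.cong[OF refl])
      fix l assume "l \<in> {..<p}"
      then show "(\<Sum>r<p. \<Sum>q<s. f ((r + p - l) mod p) q * g l q) = (\<Sum>r<p. \<Sum>q<s. f r q * g l q)"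
        using sum_cyclic_shift[of l p "\<lambda>r. \<Sum>q<s. f r q * g l q"] by simp
    qed
    also have "\<dots> = (\<Sum>l<p. \<Sum>q<s. \<Sum>r<p. f r q * g l q)"
      by (intro sum.cong refl sum.swap)
    also have "\<dots> = (\<Sum>q<s. \<Sum>l<p. \<Sum>r<p. f r q * g l q)"
      by (rule sum.swap)
    also have "\<dots> = (\<Sum>q<s. (\<Sum>r<p. f r q) * (\<Sum>l<p. g l q))"
      by (simp add: sum_distrib_left sum_distrib_right)
    also have "\<dots> = (\<Sum>q<s. Delta A k $$ (i, q) * Delta B k $$ (q, j))"
      by (rule sum.cong) (simp_all add: Delta_index[OF A p i] Delta_index[OF B p _ j] f_def g_def)
    also have "\<dots> = (Delta A k * Delta B k) $$ (i, j)"
      using i j cAB by (simp add: scalar_prod_def lessThan_atLeast0)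
    finally show "Delta (cyclic_convolution A B) k $$ (i, j) = (Delta A k * Delta B k) $$ (i, j)" .
  qed (use cAB Delta_carrier[OF C(2) p, of k] in auto)
qed

text \<open>
  Negating the slice index conjugates the Fourier weight, and the slices themselves are real, so
  the reflection turns the transposed slices into the adjoint of the transform.
\<close>

lemma Delta_ttranspose:
  assumes p: "0 < p" and A: "A \<in> tensors m n p"
  shows "Delta (ttranspose A) k = mat_adjoint (Delta A k)"
proof -
  note T = ttranspose_eq_reflection[OF p A]
  note cA = Delta_carrier[OF A p, of k]
  show ?thesis unfolding T(1)
  proof (rule eq_matI)
    fix i j assume "i < dim_row (mat_adjoint (Delta A k))" "j < dim_col (mat_adjoint (Delta A k))"
    then have i: "i < n" and j: "j < m" using cA by (auto simp: mat_adjoint_def)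
    have reflect: "(p - (p - l) mod p) mod p = l" if "l < p" for l
      using that by (cases "l = 0") auto
    have "(\<Sum>l<p. omega p ^ (k * l) * complex_of_real ((A ! ((p - l) mod p)) $$ (j, i)))
        = (\<Sum>l<p. omega p ^ (k * ((p - l) mod p)) * of_real ((A ! l) $$ (j, i)))"
      by (rule sum.reindex_bij_witness[of _ "\<lambda>l. (p - l) mod p" "\<lambda>l. (p - l) mod p"])
         (use p reflect in auto)
    also have "\<dots> = (\<Sum>l<p. cnj (omega p ^ (k * l) * of_real ((A ! l) $$ (j, i))))"
      using p by (intro sum.cong refl) (simp add: omega_power_reflect)
    finally show "Delta (map (\<lambda>k. transpose_mat (A ! ((p - k) mod p))) [0..<p]) k $$ (i, j)
        = mat_adjoint (Delta A k) $$ (i, j)"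
      using i j p cA slice_carrier[OF A]
      by (simp add: Delta_index[OF T(2) p i j] Delta_index[OF A p j i] mat_adjoint_def mat_of_rows_index
          carrier_matD[OF slice_carrier[OF A]])
  qed (use cA Delta_carrier[OF T(2) p, of k] in \<open>auto simp: mat_adjoint_def\<close>)
qed

lemma Delta_tidentity:
  assumes p: "0 < p"
  shows "Delta (tidentity n p) k = 1\<^sub>m n"
proof -
  note I = tidentity_eq[OF p, of n]
  show ?thesis unfolding I(1)
  proof (rule eq_matI)
    fix i j assume "i < dim_row (1\<^sub>m n)" "j < dim_col (1\<^sub>m n)"
    then have i: "i < n" and j: "j < n" by auto
    have "Delta (map (\<lambda>k. if k = 0 then 1\<^sub>m n else 0\<^sub>m n n) [0..<p]) k $$ (i, j)
        = (\<Sum>l<p. if l = 0 then complex_of_real (1\<^sub>m n $$ (i, j)) else 0)"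
      unfolding Delta_index[OF I(2) p i j] using i j by (intro sum.cong) auto
    then show "Delta (map (\<lambda>k. if k = 0 then 1\<^sub>m n else 0\<^sub>m n n) [0..<p]) k $$ (i, j) = 1\<^sub>m n $$ (i, j)"
      using i j p by simp
  qed (use Delta_carrier[OF I(2) p, of k] in auto)
qed

section \<open>Unitary invariance of singular values\<close>

lemma mat_adjoint_carrier:
  fixes M :: "complex mat"
  assumes "M \<in> carrier_mat m n"
  shows "mat_adjoint M \<in> carrier_mat n m"
  using assms by (auto simp: mat_adjoint_def)

lemma mat_adjoint_mult_complex:
  fixes M N :: "complex mat"
  assumes "M \<in> carrier_mat m s" "N \<in> carrier_mat s n"
  shows "mat_adjoint (M * N) = mat_adjoint N * mat_adjoint M"
  using assms
  by (intro eq_matI) (auto simp: mat_adjoint_def mat_of_rows_index scalar_prod_def mult.commute)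

lemma mat_adjoint_involution:
  fixes M :: "complex mat"
  shows "mat_adjoint (mat_adjoint M) = M"
  by (rule eq_matI) (auto simp: mat_adjoint_def mat_of_rows_index)

text \<open>
  With \<open>N = U M V\<^sup>*\<close> one has \<open>N\<^sup>* N = V (M\<^sup>* U\<^sup>* U M) V\<^sup>* = V (M\<^sup>* M) V\<^sup>*\<close>, which is similar to
  \<open>M\<^sup>* M\<close> because \<open>V\<^sup>*\<close> is the inverse of \<open>V\<close>. Similar matrices have the same characteristic
  polynomial, and \<open>N\<close> and \<open>M\<close> have the same format, so the lists agree with multiplicities.
\<close>

lemma singular_values_unitary_invariant:
  assumes M: "M \<in> carrier_mat m n" and U: "U \<in> carrier_mat m m" and V: "V \<in> carrier_mat n n"
    and UU: "mat_adjoint U * U = 1\<^sub>m m"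
    and VV: "mat_adjoint V * V = 1\<^sub>m n" "V * mat_adjoint V = 1\<^sub>m n"
  shows "singular_values (U * M * mat_adjoint V) = singular_values M"
proof -
  note c = M U V mat_adjoint_carrier[OF M] mat_adjoint_carrier[OF U] mat_adjoint_carrier[OF V]
  let ?G = "mat_adjoint M * M" and ?N = "U * M * mat_adjoint V"
  have N: "?N \<in> carrier_mat m n" and G: "?G \<in> carrier_mat n n" using c by auto
  have UM: "U * M \<in> carrier_mat m n" using c by auto
  have assoc: "X * Y * Z = X * (Y * Z)" if "dim_col X = dim_row Y" "dim_col Y = dim_row Z"
    for X Y Z :: "complex mat"
    by (rule assoc_mult_mat) (use that in auto)
  have "mat_adjoint ?N * ?N = (V * (mat_adjoint M * mat_adjoint U)) * (U * M * mat_adjoint V)"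
    by (simp add: mat_adjoint_mult_complex[OF UM c(6)] mat_adjoint_mult_complex[OF U M]
        mat_adjoint_involution)
  also have "\<dots> = V * (mat_adjoint M * (mat_adjoint U * U) * M) * mat_adjoint V"
    using c by (simp add: assoc carrier_matD[OF M] carrier_matD[OF U] carrier_matD[OF V]
        carrier_matD[OF c(4)] carrier_matD[OF c(5)] carrier_matD[OF c(6)])
  also have "\<dots> = V * ?G * mat_adjoint V"
    using c by (simp add: UU)
  finally have eq: "mat_adjoint ?N * ?N = V * ?G * mat_adjoint V" .
  have "similar_mat (V * ?G * mat_adjoint V) ?G"
    unfolding similar_mat_def
    by (rule exI[of _ V], rule exI[of _ "mat_adjoint V"])
       (use c G VV in \<open>auto simp: similar_mat_wit_def Let_def\<close>)
  then have "char_poly (mat_adjoint ?N * ?N) = char_poly ?G"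
    unfolding eq by (rule char_poly_similar)
  then show ?thesis
    unfolding singular_values_def carrier_matD[OF N] carrier_matD[OF M] by simp
qed

section \<open>Orthogonal equivalence\<close>

lemma Delta_orthogonal_unitary:
  assumes p: "0 < p" and Q: "orthogonal_tensor n p Q"
  shows "Delta Q k * mat_adjoint (Delta Q k) = 1\<^sub>m n" "mat_adjoint (Delta Q k) * Delta Q k = 1\<^sub>m n"
proof -
  have c: "Q \<in> tensors n n p" and e: "Q *\<^sub>T ttranspose Q = tidentity n p" "ttranspose Q *\<^sub>T Q = tidentity n p"
    using Q by (auto simp: orthogonal_tensor_def)
  have t: "ttranspose Q \<in> tensors n n p"
    using ttranspose_eq_reflection[OF p c] by simp
  show "Delta Q k * mat_adjoint (Delta Q k) = 1\<^sub>m n"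
    by (metis Delta_tprod[OF p c t] Delta_ttranspose[OF p c] Delta_tidentity[OF p] e(1))
  show "mat_adjoint (Delta Q k) * Delta Q k = 1\<^sub>m n"
    by (metis Delta_tprod[OF p t c] Delta_ttranspose[OF p c] Delta_tidentity[OF p] e(2))
qed

lemma singular_values_Delta_equivalent:
  assumes p: "0 < p" and eq: "orthogonally_equivalent m n p A B"
  shows "singular_values (Delta A k) = singular_values (Delta B k)"
proof -
  obtain Y Z where B: "B \<in> tensors m n p"
    and Y: "orthogonal_tensor m p Y" and Z: "orthogonal_tensor n p Z"
    and A: "A = Y *\<^sub>T B *\<^sub>T ttranspose Z"
    using eq by (auto simp: orthogonally_equivalent_def)
  have cY: "Y \<in> tensors m m p" and cZ: "Z \<in> tensors n n p"
    using Y Z by (auto simp: orthogonal_tensor_def)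
  have cT: "ttranspose Z \<in> tensors n n p"
    using ttranspose_eq_reflection[OF p cZ] by simp
  have cYB: "Y *\<^sub>T B \<in> tensors m n p"
    using tprod_eq_convolution[OF p cY B] by simp
  have "Delta A k = Delta Y k * Delta B k * mat_adjoint (Delta Z k)"
    unfolding A by (simp add: Delta_tprod[OF p cYB cT] Delta_tprod[OF p cY B] Delta_ttranspose[OF p cZ])
  then show ?thesis
    using singular_values_unitary_invariant[OF Delta_carrier[OF B p] Delta_carrier[OF cY p]
        Delta_carrier[OF cZ p] Delta_orthogonal_unitary(2)[OF p Y]
        Delta_orthogonal_unitary(2,1)[OF p Z]]
    by simp
qed

theorem corollary4p2:
  fixes m n p :: nat and A B :: tensor
  assumes "0 < m" and "0 < n" and "0 < p"
    and "orthogonally_equivalent m n p A B"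
  shows "T_rank A = T_rank B \<and> tensor_singular_values A = tensor_singular_values B"
proof -
  have A: "A \<in> tensors m n p" and B: "B \<in> tensors m n p"
    using assms(4) by (auto simp: orthogonally_equivalent_def)
  note d = tensors_dims[OF A assms(3)] tensors_dims[OF B assms(3)]
  have km: "km_coeff A = km_coeff B"
    by (intro ext) (simp add: km_coeff_def d singular_values_Delta_equivalent[OF assms(3,4)])
  have "kilmer_martin A = kilmer_martin B"
    unfolding kilmer_martin_def d km ..
  then show ?thesis
    by (simp add: T_rank_def tensor_singular_values_def d)
qed

end
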